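(* Let $0<\alpha<1$, $T>0$, and let $g_0,g_m\in\mathbb{R}$ with $g_0>0$ and $g_0>g_m$. Consider the problem of finding a pair $(v,s)$ such that $$\begin{array}{lll} (i) & \frac{\partial}{\partial t}v(x,t)-\frac{\partial}{\partial x}\,{}^C_0D_x^\alpha v(x,t)=0, & 0<x<s(t),\ 0<t<T,\\ (ii) & \lim\limits_{x\to0^+}{}^C_0D_x^\alpha v(x,t)=-g_0\,t^{-\frac{\alpha}{1+\alpha}}, & 0<t<T,\\ (iii) & v(s(t),t)=g_m, & 0<t<T,\\ (iv) & s(0)=0, & \\ (v) & \dot{s}(t)=-({}^C_0D_x^\alpha v)(s(t),t), & 0<t<T. \end{array}$$ Define $$G_\alpha(x)=g_0\left((1+\alpha)-\frac{1}{\Gamma(\alpha)}\int_0^xw\,\sigma_\alpha(w)\,dw\right),\qquad x\ge0.$$ Then the equation $G_\alpha(x)=x$, $x>0$, has a unique solution $\eta_\alpha\in\mathbb{R}^+$, and the pair $$v_\alpha(x,t)=g_m+\frac{g_0}{\Gamma(\alpha)}\int_{x/t^{1/(1+\alpha)}}^{\eta_\alpha}w^{\alpha-1}E_{\alpha,1+\frac1\alpha,1}\left(-\frac{w^{1+\alpha}}{1+\alpha}\right)dw,\qquad s_\alpha(t)=\eta_\alpha\,t^{\frac{1}{1+\alpha}},$$ is a solution of the problem (i)–(v).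
   Context: For $0<\alpha<1$ the Caputo derivative in the space variable is ${}^C_0D_x^{\alpha}v(x,t)=\frac{1}{\Gamma(1-\alpha)}\int_0^x\frac{v_x(p,t)}{(x-p)^\alpha}\,dp$. In condition (v), $({}^C_0D_x^\alpha v)(s(t),t)$ means $\lim_{x\to s(t)^-}{}^C_0D_x^\alpha v(x,t)$. Equation (i) is understood pointwise: all derivatives and integrals involved exist (the integral defining the Caputo derivative converging absolutely) and the identity holds. The formula for $s_\alpha$ is also used at $t=0$, giving $s_\alpha(0)=0$. The three-parametric Mittag-Leffler function is, for $\alpha>0$, $m>0$ and $l$ with $\alpha(jm+l)\neq-1,-2,-3,\dots$ for $j=0,1,2,\dots$, $$E_{\alpha,m,l}(z)=\sum_{n=0}^\infty c_nz^n,\qquad c_0=1,\quad c_n=\prod_{j=0}^{n-1}\frac{\Gamma(\alpha(jm+l)+1)}{\Gamma(\alpha(jm+l+1)+1)}\ (n\ge1).$$ The function $\sigma_\alpha:\mathbb{R}^+\to\mathbb{R}$ is $\sigma_\alpha(w)=w^{\alpha-1}E_{\alpha,1+\frac1\alpha,1}\left(-\frac{w^{1+\alpha}}{1+\alpha}\right)$. *)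

theory Defs
  imports "HOL-Analysis.Analysis"
begin

text \<open>Caputo derivative of order \<open>\<alpha> \<in> (0,1)\<close> with base point 0 of a function of one real variable.
  \<open>caputo_exists\<close> says that the derivative under the integral exists on the open interval
  \<open>(0,x)\<close> and that the integral converges absolutely; otherwise the value of \<open>caputo\<close> is
  meaningless.\<close>

definition caputo :: "real \<Rightarrow> (real \<Rightarrow> real) \<Rightarrow> real \<Rightarrow> real" where
  "caputo \<alpha> f x = 1 / Gamma (1 - \<alpha>) * (LBINT p=0..x. deriv f p / (x - p) powr \<alpha>)"

definition caputo_exists :: "real \<Rightarrow> (real \<Rightarrow> real) \<Rightarrow> real \<Rightarrow> bool" where
  "caputo_exists \<alpha> f x \<longleftrightarrow>
     (\<forall>p\<in>{0<..<x}. f field_differentiable (at p)) \<and>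
     interval_lebesgue_integrable lborel 0 x (\<lambda>p. deriv f p / (x - p) powr \<alpha>)"

definition ml3_coeff :: "real \<Rightarrow> real \<Rightarrow> real \<Rightarrow> nat \<Rightarrow> real" where
  "ml3_coeff \<alpha> m l n =
     (\<Prod>j<n. Gamma (\<alpha> * (real j * m + l) + 1) / Gamma (\<alpha> * (real j * m + l + 1) + 1))"

definition mittag_leffler3 :: "real \<Rightarrow> real \<Rightarrow> real \<Rightarrow> real \<Rightarrow> real" where
  "mittag_leffler3 \<alpha> m l z = (\<Sum>n. ml3_coeff \<alpha> m l n * z ^ n)"

definition sigma_fun :: "real \<Rightarrow> real \<Rightarrow> real" where
  "sigma_fun \<alpha> w =
     w powr (\<alpha> - 1) * mittag_leffler3 \<alpha> (1 + 1 / \<alpha>) 1 (- (w powr (1 + \<alpha>)) / (1 + \<alpha>))"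

text \<open>Solutions \<open>(v, s)\<close> of the fractional Stefan problem. The function \<open>v\<close> is total, but
  it is only constrained through its values for \<open>0 < x \<le> s t\<close>, \<open>0 < t < T\<close> (and, in
  derivatives, near such points). The flux at the free boundary in the last condition is the
  left-hand limit of the Caputo derivative.\<close>

definition stefan_solution ::
  "real \<Rightarrow> real \<Rightarrow> real \<Rightarrow> real \<Rightarrow> (real \<Rightarrow> real \<Rightarrow> real) \<Rightarrow> (real \<Rightarrow> real) \<Rightarrow> bool" where
  "stefan_solution \<alpha> T g0 gm v s \<longleftrightarrow>
     (\<forall>t x. 0 < t \<and> t < T \<and> 0 < x \<and> x < s t \<longrightarrow>
        caputo_exists \<alpha> (\<lambda>y. v y t) x \<and>
        (\<exists>vt dx. ((\<lambda>\<tau>. v x \<tau>) has_real_derivative vt) (at t) \<and>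
                 (caputo \<alpha> (\<lambda>y. v y t) has_real_derivative dx) (at x) \<and>
                 vt - dx = 0)) \<and>
     (\<forall>t. 0 < t \<and> t < T \<longrightarrow>
        (caputo \<alpha> (\<lambda>y. v y t) \<longlongrightarrow> - g0 * t powr (- (\<alpha> / (1 + \<alpha>)))) (at_right 0)) \<and>
     (\<forall>t. 0 < t \<and> t < T \<longrightarrow> v (s t) t = gm) \<and>
     s 0 = 0 \<and>
     (\<forall>t. 0 < t \<and> t < T \<longrightarrow>
        (\<exists>q. (caputo \<alpha> (\<lambda>y. v y t) \<longlongrightarrow> q) (at_left (s t)) \<and>
             (s has_real_derivative - q) (at t)))"

definition G_fun :: "real \<Rightarrow> real \<Rightarrow> real \<Rightarrow> real" where
  "G_fun \<alpha> g0 x = g0 * ((1 + \<alpha>) - 1 / Gamma \<alpha> * (LBINT w=0..x. w * sigma_fun \<alpha> w))"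

definition v_sol :: "real \<Rightarrow> real \<Rightarrow> real \<Rightarrow> real \<Rightarrow> real \<Rightarrow> real \<Rightarrow> real" where
  "v_sol \<alpha> g0 gm \<eta> x t =
     gm + g0 / Gamma \<alpha> *
       (LBINT w=ereal (x / t powr (1 / (1 + \<alpha>)))..\<eta>.
          w powr (\<alpha> - 1) *
          mittag_leffler3 \<alpha> (1 + 1 / \<alpha>) 1 (- (w powr (1 + \<alpha>)) / (1 + \<alpha>)))"

definition s_sol :: "real \<Rightarrow> real \<Rightarrow> real \<Rightarrow> real" where
  "s_sol \<alpha> \<eta> t = \<eta> * t powr (1 / (1 + \<alpha>))"

end

theory Submission
  imports Defs "HOL-Real_Asymp.Real_Asymp"
begin

text \<open>
  Write \<open>\<beta> = 1 + \<alpha>\<close> and \<open>\<sigma>\<close> for \<^const>\<open>sigma_fun\<close>. Integrating the power series of \<open>\<sigma>\<close> term by term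
  against \<open>(x - p) powr (- \<alpha>)\<close> (Beta integrals), the recursion of the coefficients shows that the
  fractional integral \<open>F = I\<^sup>1\<^sup>-\<^sup>\<alpha> \<sigma>\<close> satisfies \<open>F' x = - x \<sigma>(x) / \<beta>\<close>. By self-similarity the Caputo
  derivative of \<open>v\<close> is \<open>- g\<^sub>0 / \<Gamma>(\<alpha>) t powr (- \<alpha> / \<beta>) F (x / t powr (1 / \<beta>))\<close>, and the equation and the
  boundary conditions follow from the formula for \<open>F'\<close>. Moreover \<open>G = g\<^sub>0 \<beta> / \<Gamma>(\<alpha>) F\<close>, so the fixed point of
  \<open>G\<close> is unique once \<open>\<sigma> > 0\<close>. Positivity is a maximum principle: at a first zero \<open>x\<^sub>0\<close> of \<open>\<sigma>\<close> the
  formula gives \<open>F' x\<^sub>0 = 0\<close>, whereas the backward difference quotients of \<open>I\<^sup>1\<^sup>-\<^sup>\<alpha> \<sigma>\<close> stay below a negative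
  constant, because the kernel decreases and \<open>\<sigma>\<close> vanishes to first order at \<open>x\<^sub>0\<close>.
\<close>

section \<open>Log-convexity bound for Gamma quotients and a scaled Beta integral\<close>

lemma Gamma_ratio_le:
  fixes x \<alpha> :: real
  assumes "0 < \<alpha>" "\<alpha> < 1" "1 < x + \<alpha>" "0 < x"
  shows "Gamma x / Gamma (x + \<alpha>) \<le> (x + \<alpha> - 1) powr (- \<alpha>)"
proof -
  \<comment> \<open>The point x is the convex combination of y and y + 1 with weights \<alpha> and 1
    - \<alpha>, so log-convexity bounds Gamma x; the power y^(-\<alpha>) then comes from Gamma (y +
    1) = y Gamma y.\<close>
  define y where "y = x + \<alpha> - 1"
  have y: "y > 0" "x + \<alpha> = y + 1" using assms by (auto simp: y_def)
  have x: "x = (1 - (1 - \<alpha>)) * y + (1 - \<alpha>) * (y + 1)"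
    by (simp add: y_def algebra_simps)
  have "(ln \<circ> Gamma) ((1 - (1 - \<alpha>)) *\<^sub>R y + (1 - \<alpha>) *\<^sub>R (y + 1))
      \<le> (1 - (1 - \<alpha>)) * (ln \<circ> Gamma) y + (1 - \<alpha>) * (ln \<circ> Gamma) (y + 1)"
    by (rule convex_onD[OF log_convex_Gamma_real]) (use assms y in auto)
  then have "ln (Gamma x) \<le> \<alpha> * ln (Gamma y) + (1 - \<alpha>) * ln (Gamma (y + 1))"
    using x by simp
  also have "Gamma (y + 1) = y * Gamma y"
    using y by (intro Gamma_plus1) (auto elim!: nonpos_Ints_cases)
  then have G: "ln (Gamma (y + 1)) = ln y + ln (Gamma y)"
    using y by (simp add: ln_mult Gamma_real_pos less_imp_neq[symmetric])
  finally have "ln (Gamma x) \<le> ln (Gamma (x + \<alpha>)) - \<alpha> * ln y"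
    using y G by (simp add: algebra_simps)
  then have "ln (Gamma x / Gamma (x + \<alpha>)) \<le> ln (y powr (- \<alpha>))"
    using y assms by (simp add: ln_div ln_powr Gamma_real_pos less_imp_neq[symmetric])
  then show ?thesis
    unfolding y_def[symmetric]
    using ln_le_cancel_iff[of "Gamma x / Gamma (x + \<alpha>)" "y powr (- \<alpha>)"]
      Gamma_real_pos[of x] Gamma_real_pos[of "x + \<alpha>"] y assms
    by simp
qed

text \<open>The substitution p = x t reduces this to the standard Beta integral on (0,1). The
  integrand is nonnegative, so the gauge integral passes through the nonnegative integral to a
  Bochner integral, even when the endpoints are singular.\<close>

lemma has_bochner_integral_Beta:
  fixes a b x :: real
  assumes "0 < a" "0 < b" "0 < x"
  shows "has_bochner_integral lborel
     (\<lambda>p. indicator {0<..<x} p * (p powr (a - 1) * (x - p) powr (b - 1)))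
     (Beta a b * x powr (a + b - 1))"
proof -
  define f where "f = (\<lambda>p::real. indicator {0<..<x} p * (p powr (a - 1) * (x - p) powr (b - 1)))"
  have "((\<lambda>t. t powr (a - 1) * (1 - t) powr (b - 1)) has_integral Beta a b) {0<..<1}"
    using has_integral_Beta_real[of a b] assms by (simp add: has_integral_Icc_iff_Ioo)
  then have nn: "integral\<^sup>N lborel
      (\<lambda>t. ennreal (t powr (a - 1) * (1 - t) powr (b - 1)) * indicator {0<..<1} t) = ennreal (Beta a b)"
    by (intro nn_integral_has_integral_lebesgue') auto
  have B: "has_bochner_integral lborel
      (\<lambda>t. indicator {0<..<1} t * (t powr (a - 1) * (1 - t) powr (b - 1))) (Beta a b)"
  proof (rule has_bochner_integral_nn_integral)
    have "(\<integral>\<^sup>+ t. ennreal (indicator {0<..<1} t * (t powr (a - 1) * (1 - t) powr (b - 1))) \<partial>lborel)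
      = integral\<^sup>N lborel (\<lambda>t. ennreal (t powr (a - 1) * (1 - t) powr (b - 1)) * indicator {0<..<1} t)"
      by (intro nn_integral_cong) (simp add: indicator_def)
    then show "(\<integral>\<^sup>+ t. ennreal (indicator {0<..<1} t * (t powr (a - 1) * (1 - t) powr (b - 1))) \<partial>lborel)
      = ennreal (Beta a b)" using nn by simp
    show "0 \<le> Beta a b" using assms by (simp add: Beta_def)
  qed auto
  have sc: "f (0 + x * t) = x powr (a + b - 2) *
      (indicator {0<..<1} t * (t powr (a - 1) * (1 - t) powr (b - 1)))" for t
  proof (cases "t \<in> {0<..<1}")
    case True
    then have "x - x * t = x * (1 - t)" "x * t \<in> {0<..<x}" using assms by (auto simp: algebra_simps)
    then show ?thesis using True assms
      by (simp add: f_def powr_mult mult_ac flip: powr_add)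
  next
    case False
    then have "x * t \<notin> {0<..<x}" using assms by (auto simp: zero_less_mult_iff)
    then show ?thesis using False by (simp add: f_def)
  qed
  have "has_bochner_integral lborel (\<lambda>t. f (0 + x * t)) (x powr (a + b - 2) * Beta a b)"
    unfolding sc by (intro has_bochner_integral_mult_right B)
  \<comment> \<open>The Jacobian 1/x accounts for the difference between the exponents a + b - 2 and
    a + b - 1.\<close>
  also have "x powr (a + b - 2) * Beta a b = (Beta a b * x powr (a + b - 1)) /\<^sub>R \<bar>x\<bar>"
    using assms powr_diff[of x "a + b - 1" 1] by (simp add: field_simps)
  finally show ?thesis
    using assms by (subst (asm) lborel_has_bochner_integral_real_affine_iff[symmetric]) (auto simp: f_def)
qed

section \<open>Power series coefficients of \<sigma> and of its fractional integral\<close>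

locale caputo_order =
  fixes \<alpha> :: real
  assumes \<alpha>_pos: "0 < \<alpha>" and \<alpha>_less_1: "\<alpha> < 1"
begin

abbreviation \<beta> :: real where "\<beta> \<equiv> 1 + \<alpha>"

text \<open>The sign and the factor 1/\<beta> of the Mittag-Leffler argument are absorbed into the
  coefficients, so that \<sigma>(w) = w^(\<alpha> - 1) \<open>E\<close> (w^\<beta>).\<close>

definition a :: "nat \<Rightarrow> real" where
  "a n = ml3_coeff \<alpha> (1 + 1 / \<alpha>) 1 n * (- 1 / \<beta>) ^ n"

text \<open>Integrating w^(\<beta> n + \<alpha> - 1) against (x - w)^(-\<alpha>) produces Gamma
  (\<beta> n + \<alpha>) Gamma (1 - \<alpha>) / Gamma (\<beta> n + 1); the factor Gamma (1 -
  \<alpha>), common to all n, is left out here.\<close>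

definition b :: "nat \<Rightarrow> real" where
  "b n = a n * Gamma (\<beta> * n + \<alpha>) / Gamma (\<beta> * n + 1)"

definition E :: "real \<Rightarrow> real" where
  "E y = (\<Sum>n. a n * y ^ n)"

definition F :: "real \<Rightarrow> real" where
  "F x = (\<Sum>n. b n * (x powr \<beta>) ^ n)"

lemma a_0 [simp]: "a 0 = 1"
  by (simp add: a_def ml3_coeff_def)

lemma b_0 [simp]: "b 0 = Gamma \<alpha>"
  by (simp add: b_def)

lemma a_Suc: "a (Suc n) = - (a n * (Gamma (\<beta> * Suc n) / Gamma (\<beta> * Suc n + \<alpha>)) / \<beta>)"
proof -
  \<comment> \<open>With m = 1 + 1/\<alpha> both Gamma arguments advance by \<beta> in each step and
    differ from each other by \<alpha>.\<close>
  have e: "\<alpha> * (real n * (1 + 1 / \<alpha>) + 1) + 1 = \<beta> * Suc n"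
    "\<alpha> * (real n * (1 + 1 / \<alpha>) + 1 + 1) + 1 = \<beta> * Suc n + \<alpha>"
    using \<alpha>_pos by (simp_all add: field_simps)
  show ?thesis
    unfolding a_def ml3_coeff_def prod.lessThan_Suc e by (simp add: field_simps)
qed

text \<open>The factor Gamma (u + \<alpha>) in \<open>b\<close> cancels the denominator of the
  recursion for \<open>a\<close>, and Gamma u / Gamma (u + 1) = 1/u. This coefficient identity is
  the source of the differential equation for \<open>F\<close>.\<close>

lemma b_Suc: "b (Suc n) * Suc n = - (a n / \<beta> ^ 2)"
proof -
  define u where "u = \<beta> * Suc n"
  have u: "u > 0" unfolding u_def using \<alpha>_pos by simp
  have "Gamma (u + 1) = u * Gamma u"
    using u by (intro Gamma_plus1) (auto elim!: nonpos_Ints_cases)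
  moreover have "Gamma u \<noteq> 0" "Gamma (u + \<alpha>) \<noteq> 0"
    using u \<alpha>_pos Gamma_real_pos[of u] Gamma_real_pos[of "u + \<alpha>"] by linarith+
  ultimately have "b (Suc n) * u = - (a n / \<beta>)"
    unfolding b_def a_Suc u_def[symmetric] using u by simp
  then have "\<beta> * (b (Suc n) * Suc n) = - (a n / \<beta>)"
    by (simp only: u_def mult_ac)
  then have "b (Suc n) * Suc n = - (a n / \<beta>) / \<beta>"
    using \<alpha>_pos by (subst eq_divide_eq) (simp add: mult_ac)
  then show ?thesis by (simp add: power2_eq_square)
qed

text \<open>By \<open>Gamma_ratio_le\<close> the coefficient ratios tend to 0, so the ratio test
  applies at every z. Absolute values are kept because the exchange of sum and integral later needs
  them.\<close>

lemma summable_a: "summable (\<lambda>n. \<bar>a n\<bar> * \<bar>z\<bar> ^ n)"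
proof -
  have "((\<lambda>n::nat. (\<beta> * Suc n + \<alpha> - 1) powr (- \<alpha>)) \<longlongrightarrow> 0) sequentially"
    using \<alpha>_pos by real_asymp
  then have "((\<lambda>n::nat. (\<beta> * Suc n + \<alpha> - 1) powr (- \<alpha>) / \<beta> * \<bar>z\<bar>) \<longlongrightarrow> 0 / \<beta> * \<bar>z\<bar>) sequentially"
    using \<alpha>_pos by (intro tendsto_intros) auto
  then have "\<forall>\<^sub>F n in sequentially. (\<beta> * Suc n + \<alpha> - 1) powr (- \<alpha>) / \<beta> * \<bar>z\<bar> < 1 / 2"
    by (rule order_tendstoD(2)) simp
  then obtain N where N: "\<And>n. n \<ge> N \<Longrightarrow> (\<beta> * Suc n + \<alpha> - 1) powr (- \<alpha>) / \<beta> * \<bar>z\<bar> < 1 / 2"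
    by (auto simp: eventually_sequentially)
  show ?thesis
  proof (rule summable_ratio_test[of "1/2" N])
    fix n assume n: "n \<ge> N"
    have ge: "\<beta> * Suc n \<ge> 1" using \<alpha>_pos by (simp add: algebra_simps add_increasing2)
    define r where "r = Gamma (\<beta> * Suc n) / Gamma (\<beta> * Suc n + \<alpha>)"
    have r: "0 \<le> r" "r \<le> (\<beta> * Suc n + \<alpha> - 1) powr (- \<alpha>)"
      using Gamma_ratio_le[of \<alpha> "\<beta> * Suc n"] ge \<alpha>_pos \<alpha>_less_1
      by (auto simp: r_def intro!: divide_nonneg_nonneg less_imp_le[OF Gamma_real_pos])
    have "r / \<beta> * \<bar>z\<bar> \<le> (\<beta> * Suc n + \<alpha> - 1) powr (- \<alpha>) / \<beta> * \<bar>z\<bar>"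
      using r \<alpha>_pos by (intro mult_right_mono divide_right_mono) auto
    then have q: "r / \<beta> * \<bar>z\<bar> \<le> 1 / 2" using N[OF n] by linarith
    have "\<bar>a (Suc n)\<bar> * \<bar>z\<bar> ^ Suc n = (r / \<beta> * \<bar>z\<bar>) * (\<bar>a n\<bar> * \<bar>z\<bar> ^ n)"
      unfolding a_Suc r_def[symmetric] using r \<alpha>_pos by (simp add: abs_mult)
    also have "\<dots> \<le> 1 / 2 * (\<bar>a n\<bar> * \<bar>z\<bar> ^ n)"
      using q by (intro mult_right_mono) auto
    finally show "norm (\<bar>a (Suc n)\<bar> * \<bar>z\<bar> ^ Suc n) \<le> 1 / 2 * norm (\<bar>a n\<bar> * \<bar>z\<bar> ^ n)"
      by simp
  qed simp
qed

text \<open>By \<open>b_Suc\<close> the coefficient with index n + 1 is at most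
  |\<open>a n\<close>|, so the shifted series is dominated by the series of
  \<open>a\<close>.\<close>

lemma summable_b: "summable (\<lambda>n. \<bar>b n\<bar> * \<bar>z\<bar> ^ n)"
proof -
  have "summable (\<lambda>n. \<bar>b (Suc n)\<bar> * \<bar>z\<bar> ^ Suc n)"
  proof (rule summable_comparison_test')
    show "summable (\<lambda>n. \<bar>z\<bar> * (\<bar>a n\<bar> * \<bar>z\<bar> ^ n))"
      by (intro summable_mult summable_a)
    fix n :: nat assume "n \<ge> 0"
    have "\<bar>b (Suc n)\<bar> \<le> \<bar>b (Suc n) * Suc n\<bar>"
      by (simp add: abs_mult mult_le_cancel_left1)
    also have "\<dots> = \<bar>a n\<bar> / \<beta> ^ 2" unfolding b_Suc by simp
    also have "\<dots> \<le> \<bar>a n\<bar>"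
      using \<alpha>_pos by (simp add: divide_le_eq mult_le_cancel_left1 one_le_power)
    finally have "\<bar>b (Suc n)\<bar> \<le> \<bar>a n\<bar>" .
    then have "\<bar>z\<bar> * (\<bar>b (Suc n)\<bar> * \<bar>z\<bar> ^ n) \<le> \<bar>z\<bar> * (\<bar>a n\<bar> * \<bar>z\<bar> ^ n)"
      by (intro mult_left_mono mult_right_mono) auto
    then show "norm (\<bar>b (Suc n)\<bar> * \<bar>z\<bar> ^ Suc n) \<le> \<bar>z\<bar> * (\<bar>a n\<bar> * \<bar>z\<bar> ^ n)"
      by (simp add: mult_ac)
  qed
  then show ?thesis by (subst (asm) summable_Suc_iff)
qed

lemma summable_a': "summable (\<lambda>n. a n * z ^ n)"
proof (rule summable_norm_cancel)
  have "norm (a n * z ^ n) = \<bar>a n\<bar> * \<bar>z\<bar> ^ n" for n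
    by (simp add: abs_mult power_abs)
  then show "summable (\<lambda>n. norm (a n * z ^ n))"
    using summable_a[of z] by (simp only:)
qed

lemma summable_b': "summable (\<lambda>n. b n * z ^ n)"
proof (rule summable_norm_cancel)
  have "norm (b n * z ^ n) = \<bar>b n\<bar> * \<bar>z\<bar> ^ n" for n
    by (simp add: abs_mult power_abs)
  then show "summable (\<lambda>n. norm (b n * z ^ n))"
    using summable_b[of z] by (simp only:)
qed

section \<open>The series as functions, their derivatives, and the fractional integral of
  \<sigma>\<close>

lemma DERIV_E: "(E has_real_derivative (\<Sum>n. diffs a n * y ^ n)) (at y)"
  unfolding E_def by (rule termdiffs_strong_converges_everywhere) (rule summable_a')

lemma isCont_E: "isCont E y"
  using DERIV_E DERIV_isCont by blast

lemma sigma_fun_eq: "sigma_fun \<alpha> w = w powr (\<alpha> - 1) * E (w powr \<beta>)"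
proof -
  have "(- (w powr \<beta>) / \<beta>) ^ n = (- 1 / \<beta>) ^ n * (w powr \<beta>) ^ n" for n
    unfolding power_mult_distrib[symmetric] by simp
  then show ?thesis
    by (simp add: sigma_fun_def mittag_leffler3_def E_def a_def mult.assoc)
qed

text \<open>Differentiating the series in y = x^\<beta> gives -E(y)/\<beta>^2 by
  \<open>b_Suc\<close>. The inner derivative \<beta> x^\<alpha> = \<beta> x x^(\<alpha> - 1) then
  restores the singular factor of \<sigma>.\<close>

lemma DERIV_F:
  assumes "0 < x"
  shows "(F has_real_derivative - (x * sigma_fun \<alpha> x) / \<beta>) (at x)"
proof -
  have "((\<lambda>y. \<Sum>n. b n * y ^ n) has_real_derivative (\<Sum>n. diffs b n * (x powr \<beta>) ^ n)) (at (x powr \<beta>))"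
    by (rule termdiffs_strong_converges_everywhere) (rule summable_b')
  moreover have "diffs b n * y ^ n = - (1 / \<beta> ^ 2) * (a n * y ^ n)" for n y
    using b_Suc[of n] by (simp add: diffs_def mult.commute)
  ultimately have D: "((\<lambda>y. \<Sum>n. b n * y ^ n) has_real_derivative - (1 / \<beta> ^ 2) * E (x powr \<beta>)) (at (x powr \<beta>))"
    unfolding E_def by (simp only: suminf_mult[OF summable_a'])
  have "((\<lambda>x. x powr \<beta>) has_real_derivative \<beta> * x powr \<alpha>) (at x)"
    using has_real_derivative_powr[OF assms, of \<beta>] by simp
  from DERIV_chain2[OF D this]
  have "(F has_real_derivative - (1 / \<beta> ^ 2) * E (x powr \<beta>) * (\<beta> * x powr \<alpha>)) (at x)"
    by (simp add: F_def[abs_def])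
  moreover have "x powr \<alpha> = x * x powr (\<alpha> - 1)"
    using assms by (simp add: powr_diff)
  moreover have "- (1 / B ^ 2) * e * (B * (x * p)) = - (x * (p * e)) / B"
    if "B \<noteq> 0" for B e p :: real
    using that by (simp add: field_simps power2_eq_square)
  ultimately show ?thesis
    using \<alpha>_pos by (simp only: sigma_fun_eq)
qed

lemma tendsto_F_0: "(F \<longlongrightarrow> Gamma \<alpha>) (at_right 0)"
proof -
  have "isCont (\<lambda>y. \<Sum>n. b n * y ^ n) 0"
    by (rule isCont_powser_converges_everywhere) (rule summable_b')
  moreover have "((\<lambda>x. x powr \<beta>) \<longlongrightarrow> 0) (at_right (0::real))"
    using \<alpha>_pos by real_asymp
  ultimately show ?thesis
    unfolding F_def[abs_def] using isCont_tendsto_compose by (fastforce simp: powser_zero)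
qed

lemma F_0: "F 0 = Gamma \<alpha>"
  by (simp add: F_def powser_zero)

lemma DERIV_sigma:
  assumes "0 < x"
  shows "\<exists>D. (sigma_fun \<alpha> has_real_derivative D) (at x)"
proof -
  have "((\<lambda>w. E (w powr \<beta>)) has_real_derivative
      (\<Sum>n. diffs a n * (x powr \<beta>) ^ n) * (\<beta> * x powr (\<beta> - 1))) (at x)"
    by (rule DERIV_chain2[OF DERIV_E has_real_derivative_powr[OF assms]])
  from DERIV_mult[OF has_real_derivative_powr[OF assms, of "\<alpha> - 1"] this]
  show ?thesis unfolding sigma_fun_eq[abs_def] by blast
qed

lemma isCont_sigma: "0 < x \<Longrightarrow> isCont (sigma_fun \<alpha>) x"
  using DERIV_sigma DERIV_isCont by blast

text \<open>Each term of the series of \<sigma> is integrated as a Beta integral. The scale k serves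
  two uses: k = 1 for the positivity of \<sigma>, and k = t^(-1/\<beta>) for the self-similar
  solution.\<close>

lemma has_bochner_integral_fractional:
  assumes "0 < k" "0 < x"
  shows "has_bochner_integral lborel
     (\<lambda>p. indicator {0<..<x} p * (k * sigma_fun \<alpha> (k * p) * (x - p) powr (- \<alpha>)))
     (Gamma (1 - \<alpha>) * k powr \<alpha> * F (k * x))"
proof -
  define f where "f = (\<lambda>(n::nat) p. indicator {0<..<x} p * (a n * k powr (\<beta> * n + \<alpha>) * 
     (p powr (\<beta> * n + \<alpha> - 1) * (x - p) powr (1 - \<alpha> - 1))))"
  have fB: "has_bochner_integral lborel (\<lambda>p. c * (indicator {0<..<x} p * 
      (p powr (\<beta> * n + \<alpha> - 1) * (x - p) powr (1 - \<alpha> - 1))))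
      (c * (Beta (\<beta> * n + \<alpha>) (1 - \<alpha>) * x powr (\<beta> * n + \<alpha> + (1 - \<alpha>) - 1)))" for c and n :: nat
    using assms \<alpha>_pos \<alpha>_less_1
    by (intro has_bochner_integral_mult_right has_bochner_integral_Beta) (auto intro: add_nonneg_pos)
  have Gp: "Gamma (1 - \<alpha>) > 0" "Gamma (\<beta> * n + \<alpha>) > 0" "Gamma (\<beta> * n + 1) > 0" for n :: nat
    using \<alpha>_pos \<alpha>_less_1 by (auto intro!: Gamma_real_pos add_nonneg_pos)
  have pw: "((k * p) powr \<beta>) ^ n = k powr (\<beta> * n) * p powr (\<beta> * n)" if "0 < p" for n :: nat and p
    using assms that by (subst powr_power) (auto simp: powr_mult mult.commute)
  have kx: "k powr (\<beta> * n + \<alpha>) * x powr (\<beta> * n) = k powr \<alpha> * ((k * x) powr \<beta>) ^ n" for n :: nat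
    unfolding pw[OF assms(2)] powr_add[of k "\<beta> * n"] by (simp only: mult_ac)
  have kp: "k powr (\<beta> * n + \<alpha>) * p powr (\<beta> * n + \<alpha> - 1) = k * (k * p) powr (\<alpha> - 1) * ((k * p) powr \<beta>) ^ n"
    if "0 < p" for n :: nat and p
  proof -
    have "p powr (\<beta> * n + \<alpha> - 1) = p powr (\<beta> * n) * p powr (\<alpha> - 1)"
      unfolding powr_add[symmetric] by (simp add: algebra_simps)
    moreover have "k powr (\<beta> * n + \<alpha>) = k powr (\<beta> * n) * (k * k powr (\<alpha> - 1))"
      unfolding powr_add[of k "\<beta> * n"] using assms by (simp add: powr_diff)
    ultimately show ?thesis
      unfolding pw[OF that] using assms that by (simp only: powr_mult mult_ac)
  qed
  \<comment> \<open>The coefficient c is left free so that the same computation serves both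
    \<open>a n\<close>, for the integral of a term, and |\<open>a n\<close>|, for the integral of
    its norm.\<close>
  have val: "c * k powr (\<beta> * n + \<alpha>) * (Beta (\<beta> * n + \<alpha>) (1 - \<alpha>) * x powr (\<beta> * n + \<alpha> + (1 - \<alpha>) - 1))
     = (Gamma (1 - \<alpha>) * k powr \<alpha>) * (c * Gamma (\<beta> * n + \<alpha>) / Gamma (\<beta> * n + 1) * ((k * x) powr \<beta>) ^ n)"
    for c and n :: nat
    using kx[of n] by (simp add: Beta_def mult_ac)
  have f_int: "has_bochner_integral lborel (f n) (Gamma (1 - \<alpha>) * k powr \<alpha> * (b n * ((k * x) powr \<beta>) ^ n))" for n
    using fB[of "a n * k powr (\<beta> * n + \<alpha>)" n]
    unfolding val b_def[symmetric] by (simp add: f_def mult_ac)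
  have "norm (f n p) = \<bar>a n\<bar> * k powr (\<beta> * n + \<alpha>) * (indicator {0<..<x} p *
      (p powr (\<beta> * n + \<alpha> - 1) * (x - p) powr (1 - \<alpha> - 1)))" for n p
    by (simp add: f_def abs_mult)
  moreover have "\<bar>a n\<bar> * Gamma (\<beta> * n + \<alpha>) / Gamma (\<beta> * n + 1) = \<bar>b n\<bar>" for n
    using Gp(2,3)[of n] by (simp add: b_def abs_mult)
  ultimately have nf_int: "has_bochner_integral lborel (\<lambda>p. norm (f n p))
      (Gamma (1 - \<alpha>) * k powr \<alpha> * (\<bar>b n\<bar> * ((k * x) powr \<beta>) ^ n))" for n
    using fB[of "\<bar>a n\<bar> * k powr (\<beta> * n + \<alpha>)" n] unfolding val by simp
  have pt: "(\<lambda>n. \<bar>a n\<bar> * k powr (\<beta> * n + \<alpha>) * (p powr (\<beta> * n + \<alpha> - 1) * (x - p) powr (1 - \<alpha> - 1)))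
      = (\<lambda>n. k * (k * p) powr (\<alpha> - 1) * (x - p) powr (- \<alpha>) * (\<bar>a n\<bar> * ((k * p) powr \<beta>) ^ n))"
    "(\<lambda>n. a n * k powr (\<beta> * n + \<alpha>) * (p powr (\<beta> * n + \<alpha> - 1) * (x - p) powr (1 - \<alpha> - 1)))
      = (\<lambda>n. k * (k * p) powr (\<alpha> - 1) * (x - p) powr (- \<alpha>) * (a n * ((k * p) powr \<beta>) ^ n))"
    if "0 < p" for p
    using kp[OF that] by (auto simp: fun_eq_iff mult.assoc[symmetric])
  have sumf: "summable (\<lambda>n. norm (f n p))" for p
  proof (cases "p \<in> {0<..<x}")
    case True
    have "summable (\<lambda>n. \<bar>a n\<bar> * ((k * p) powr \<beta>) ^ n)"
      using summable_a[of "(k * p) powr \<beta>"] by (simp only: abs_of_nonneg[OF powr_ge_zero])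
    from summable_mult[OF this, of "k * (k * p) powr (\<alpha> - 1) * (x - p) powr (- \<alpha>)"]
    show ?thesis using True pt(1)[of p] by (simp add: f_def abs_mult)
  qed (simp add: f_def)
  have lim: "(\<Sum>n. f n p) = indicator {0<..<x} p * (k * sigma_fun \<alpha> (k * p) * (x - p) powr (- \<alpha>))" for p
  proof (cases "p \<in> {0<..<x}")
    case True
    then have "(\<lambda>n. f n p) = (\<lambda>n. k * (k * p) powr (\<alpha> - 1) * (x - p) powr (- \<alpha>) * (a n * ((k * p) powr \<beta>) ^ n))"
      using pt(2)[of p] by (simp add: f_def)
    then have "(\<Sum>n. f n p) = k * (k * p) powr (\<alpha> - 1) * (x - p) powr (- \<alpha>) * E ((k * p) powr \<beta>)"
      by (simp only: suminf_mult[OF summable_a'] E_def)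
    then show ?thesis using True by (simp add: sigma_fun_eq)
  qed (simp add: f_def)
  \<comment> \<open>Each term has constant sign, so the integrals of the norms are multiples of
    |\<open>b n\<close>| ((k x)^\<beta>)^n. Their summability justifies exchanging sum and
    integral.\<close>
  have sumn: "summable (\<lambda>n. \<integral>p. norm (f n p) \<partial>lborel)"
    using summable_mult[OF summable_b[of "(k * x) powr \<beta>"], of "Gamma (1 - \<alpha>) * k powr \<alpha>"]
    by (simp only: has_bochner_integral_integral_eq[OF nf_int] abs_of_nonneg[OF powr_ge_zero])
  have i: "integrable lborel (f n)" for n using f_int by (rule integrable.intros)
  have "(\<integral>p. (\<Sum>n. f n p) \<partial>lborel) = (\<Sum>n. Gamma (1 - \<alpha>) * k powr \<alpha> * (b n * ((k * x) powr \<beta>) ^ n))"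
    using integral_suminf[OF i _ sumn] sumf by (simp add: has_bochner_integral_integral_eq[OF f_int])
  also have "\<dots> = Gamma (1 - \<alpha>) * k powr \<alpha> * F (k * x)"
    by (simp add: suminf_mult[OF summable_b'] F_def)
  finally show ?thesis
    using integrable_suminf[OF i _ sumn] sumf unfolding has_bochner_integral_iff lim by simp
qed

section \<open>Positivity of \<sigma>\<close>

lemma powr_neg_diff_le:
  assumes "0 < y" "0 < h" "y + h \<le> z"
  shows "(y + h) powr (- \<alpha>) - y powr (- \<alpha>) \<le> - (\<alpha> * h * z powr (- \<alpha> - 1))"
proof -
  \<comment> \<open>The mean value theorem gives the slope -\<alpha> u^(-\<alpha> - 1) with u < z.
    Replacing u by z weakens the bound but makes it independent of y.\<close>
  have "\<exists>u>y. u < y + h \<and> (y + h) powr (- \<alpha>) - y powr (- \<alpha>) = (y + h - y) * (- \<alpha> * u powr (- \<alpha> - 1))"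
  proof (rule MVT2)
    show "((\<lambda>x. x powr (- \<alpha>)) has_real_derivative - \<alpha> * x powr (- \<alpha> - 1)) (at x)" if "y \<le> x" for x
      using that assms by (intro has_real_derivative_powr) auto
  qed (use assms in auto)
  then obtain u where u: "y < u" "u < y + h"
    "(y + h) powr (- \<alpha>) - y powr (- \<alpha>) = - (\<alpha> * h * u powr (- \<alpha> - 1))"
    by (auto simp: mult_ac)
  have "z powr (- \<alpha> - 1) \<le> u powr (- \<alpha> - 1)"
    using u assms \<alpha>_pos by (intro powr_mono2') auto
  then have "\<alpha> * h * z powr (- \<alpha> - 1) \<le> \<alpha> * h * u powr (- \<alpha> - 1)"
    using assms \<alpha>_pos by (intro mult_left_mono) auto
  then show ?thesis using u(3) by linarith
qed

text \<open>Shortening the range by h changes the integral in two ways. The drop of the kernel on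
  [x0/4, x0/2] contributes at most -c h x0/4, while the mass near x0 contributes at most L h^(2 -
  \<alpha>), which is o(h). Hence the derivative of \<open>F\<close> at x0 would be negative,
  although \<open>DERIV_F\<close> makes it 0 at a zero of \<sigma>.\<close>

lemma sigma_no_first_zero:
  assumes x0: "0 < x0" and pos: "\<And>p. 0 < p \<Longrightarrow> p < x0 \<Longrightarrow> 0 < sigma_fun \<alpha> p"
  shows "sigma_fun \<alpha> x0 \<noteq> 0"
proof
  assume zero: "sigma_fun \<alpha> x0 = 0"
  define \<Gamma> where "\<Gamma> = Gamma (1 - \<alpha>)"
  have frac: "has_bochner_integral lborel
      (\<lambda>p. indicator {0<..<x} p * (sigma_fun \<alpha> p * (x - p) powr (- \<alpha>))) (\<Gamma> * F x)" if "0 < x" for x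
    using has_bochner_integral_fractional[of 1 x] that by (simp add: \<Gamma>_def)
  obtain D where "(sigma_fun \<alpha> has_real_derivative D) (at x0)"
    using DERIV_sigma x0 by blast
  then have "((\<lambda>y. sigma_fun \<alpha> y / (y - x0)) \<longlongrightarrow> D) (at x0)"
    by (simp add: has_field_derivative_iff zero)
  then have "((\<lambda>y. sigma_fun \<alpha> y / (y - x0)) \<longlongrightarrow> D) (at_left x0)"
    unfolding filterlim_at_split by blast
  then have "\<forall>\<^sub>F y in at_left x0. sigma_fun \<alpha> y / (y - x0) > - (\<bar>D\<bar> + 1)"
    by (rule order_tendstoD(1)) simp
  then obtain b where b: "b < x0" "\<And>y. b < y \<Longrightarrow> y < x0 \<Longrightarrow> sigma_fun \<alpha> y / (y - x0) > - (\<bar>D\<bar> + 1)"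
    by (auto simp: eventually_at_left[of "x0 - 1" x0])
  define L where "L = \<bar>D\<bar> + 1"
  have L: "0 \<le> L" by (simp add: L_def)
  \<comment> \<open>Multiplying the quotient bound by the negative number y - x0 reverses it into a
    linear bound on \<sigma> near its zero.\<close>
  have Lip: "sigma_fun \<alpha> y \<le> L * (x0 - y)" if "b < y" "y < x0" for y
    using b(2)[OF that] that unfolding L_def[symmetric] by (simp add: field_simps)
  \<comment> \<open>This compact interval avoids both the singularity at 0 and the zero x0, so the
    minimum of \<sigma> on it is positive.\<close>
  have "\<exists>x\<in>{x0/4..x0/2}. \<forall>y\<in>{x0/4..x0/2}. sigma_fun \<alpha> x \<le> sigma_fun \<alpha> y"
    using x0 by (intro continuous_attains_inf continuous_at_imp_continuous_on ballI isCont_sigma) auto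
  then obtain x1 where x1: "x0/4 \<le> x1" "x1 \<le> x0/2"
    "\<And>y. x0/4 \<le> y \<Longrightarrow> y \<le> x0/2 \<Longrightarrow> sigma_fun \<alpha> x1 \<le> sigma_fun \<alpha> y" by auto
  define m where "m = sigma_fun \<alpha> x1"
  have m: "0 < m" using pos[of x1] x1 x0 by (simp add: m_def)
  define c where "c = m * (\<alpha> * x0 powr (- \<alpha> - 1))"
  have c: "0 < c" using m \<alpha>_pos x0 by (simp add: c_def)
  have le: "\<Gamma> * F x0 - \<Gamma> * F (x0 - h) \<le> x0 / 4 * (- c * h) + h * (L * h powr (1 - \<alpha>))"
    if h: "0 < h" "h < x0 / 2" "h < x0 - b" for h
  proof -
    define f where "f = (\<lambda>p. indicator {0<..<x0} p * (sigma_fun \<alpha> p * (x0 - p) powr (- \<alpha>))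
        - indicator {0<..<x0 - h} p * (sigma_fun \<alpha> p * (x0 - h - p) powr (- \<alpha>)))"
    \<comment> \<open>A step function dominating \<open>f\<close>: on the middle interval the kernel
      loses at least \<alpha> h x0^(-\<alpha> - 1), and on the last stretch L (x0 - p) (x0 -
      p)^(-\<alpha>) is at most L h^(1 - \<alpha>). Elsewhere \<open>f\<close> is
      nonpositive.\<close>
    define g where "g = (\<lambda>p. indicator {x0/4..x0/2} p * (- c * h) + indicator {x0 - h..x0} p * (L * h powr (1 - \<alpha>)))"
    have f: "has_bochner_integral lborel f (\<Gamma> * F x0 - \<Gamma> * F (x0 - h))"
      unfolding f_def using h x0 by (intro has_bochner_integral_diff frac) auto
    have g: "has_bochner_integral lborel g (measure lborel {x0/4..x0/2} * (- c * h)
        + measure lborel {x0 - h..x0} * (L * h powr (1 - \<alpha>)))"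
      unfolding g_def using h x0
      by (intro has_bochner_integral_add has_bochner_integral_mult_left has_bochner_integral_real_indicator) auto
    have "f p \<le> g p" for p
    proof -
      have gp: "0 \<le> L * h powr (1 - \<alpha>)" using L by simp
      consider "p \<notin> {0<..<x0}" | "x0 - h \<le> p" "p < x0" | "0 < p" "p < x0 - h"
        by fastforce
      then show ?thesis
      proof cases
        case 1
        then have "f p = 0" using h by (auto simp: f_def indicator_def)
        moreover have "p \<notin> {x0/4..x0/2}" using 1 x0 by auto
        ultimately show ?thesis using gp by (cases "p \<in> {x0 - h..x0}") (simp_all add: g_def)
      next
        case 2
        then have "f p = sigma_fun \<alpha> p * (x0 - p) powr (- \<alpha>)"
          using h x0 by (simp add: f_def)
        also have "\<dots> \<le> (L * (x0 - p)) * (x0 - p) powr (- \<alpha>)"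
          using 2 h by (intro mult_right_mono Lip) auto
        also have "\<dots> = L * (x0 - p) powr (1 - \<alpha>)"
          using 2 by (simp add: powr_diff powr_minus divide_simps)
        also have "\<dots> \<le> L * h powr (1 - \<alpha>)"
          using 2 h L \<alpha>_less_1 by (intro mult_left_mono powr_mono2) auto
        also have "\<dots> = g p" using 2 h x0 by (simp add: g_def)
        finally show ?thesis .
      next
        case 3
        define d where "d = (x0 - p) powr (- \<alpha>) - (x0 - h - p) powr (- \<alpha>)"
        have fd: "f p = sigma_fun \<alpha> p * d"
          using 3 h by (simp add: f_def d_def algebra_simps)
        have d: "d \<le> - (\<alpha> * h * x0 powr (- \<alpha> - 1))"
          using powr_neg_diff_le[of "x0 - h - p" h x0] 3 h by (simp add: d_def algebra_simps)
        have "0 \<le> \<alpha> * h * x0 powr (- \<alpha> - 1)" using \<alpha>_pos h by simp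
        then have d0: "d \<le> 0" using d by linarith
        have sp: "0 < sigma_fun \<alpha> p" using 3 h by (intro pos) auto
        show ?thesis
        proof (cases "p \<in> {x0/4..x0/2}")
          case True
          have "sigma_fun \<alpha> p * d \<le> m * d"
            using x1(3)[of p] True d0 by (intro mult_right_mono_neg) (auto simp: m_def)
          also have "\<dots> \<le> m * - (\<alpha> * h * x0 powr (- \<alpha> - 1))"
            using d m by (intro mult_left_mono) auto
          also have "\<dots> = g p" using True 3 by (simp add: g_def c_def)
          finally show ?thesis by (simp add: fd)
        next
          case False
          then have "g p = 0" using 3 by (simp add: g_def)
          then show ?thesis using sp d0 by (simp add: fd mult_nonneg_nonpos)
        qed
      qed
    qed
    then have "\<Gamma> * F x0 - \<Gamma> * F (x0 - h) \<le> measure lborel {x0/4..x0/2} * (- c * h)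
        + measure lborel {x0 - h..x0} * (L * h powr (1 - \<alpha>))"
      using f g integral_mono[of lborel f g] by (simp add: has_bochner_integral_iff)
    then show ?thesis using h x0 by simp
  qed
  \<comment> \<open>Since \<sigma>(x0) = 0, the derivative of \<open>F\<close> at x0 vanishes;
    substituting -h yields the backward difference quotients.\<close>
  have "((\<lambda>h. (F (x0 + h) - F x0) / h) \<longlongrightarrow> 0) (at 0)"
    using DERIV_F[OF x0] by (simp add: DERIV_def zero)
  moreover have "filterlim (\<lambda>h::real. - h) (at 0) (at_right 0)"
    by (auto simp: filterlim_at eventually_at_filter intro!: tendsto_eq_intros)
  ultimately have "((\<lambda>h. (F (x0 + - h) - F x0) / - h) \<longlongrightarrow> 0) (at_right 0)"
    by (rule filterlim_compose)
  from tendsto_mult_left[OF this, of \<Gamma>]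
  have l1: "((\<lambda>h. \<Gamma> * ((F (x0 + - h) - F x0) / - h)) \<longlongrightarrow> 0) (at_right 0)" by simp
  have "1 - \<alpha> > 0" using \<alpha>_less_1 by simp
  then have "((\<lambda>h. h powr (1 - \<alpha>)) \<longlongrightarrow> 0) (at_right (0::real))" by real_asymp
  then have l2: "((\<lambda>h. - (x0 / 4 * c) + L * h powr (1 - \<alpha>)) \<longlongrightarrow> - (x0 / 4 * c) + L * 0) (at_right 0)"
    by (intro tendsto_intros)
  have "\<forall>\<^sub>F h in at_right 0. h < min (x0 / 2) (x0 - b)"
    using b(1) x0 by (intro eventually_at_rightI[of 0 "min (x0 / 2) (x0 - b)"]) auto
  then have "\<forall>\<^sub>F h in at_right 0. \<Gamma> * ((F (x0 + - h) - F x0) / - h) \<le> - (x0 / 4 * c) + L * h powr (1 - \<alpha>)"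
    using eventually_at_right_less[of 0]
  proof eventually_elim
    case (elim h)
    then have "\<Gamma> * F x0 - \<Gamma> * F (x0 - h) \<le> (- (x0 / 4 * c) + L * h powr (1 - \<alpha>)) * h"
      using le[of h] by (simp add: algebra_simps)
    then have "(\<Gamma> * F x0 - \<Gamma> * F (x0 - h)) / h \<le> - (x0 / 4 * c) + L * h powr (1 - \<alpha>)"
      using elim by (subst pos_divide_le_eq) auto
    moreover have "\<Gamma> * ((F (x0 + - h) - F x0) / - h) = (\<Gamma> * F x0 - \<Gamma> * F (x0 - h)) / h"
      using elim by (simp add: field_simps)
    ultimately show ?case by simp
  qed
  from tendsto_le[OF _ l2 l1 this] have "0 \<le> - (x0 / 4 * c)" by simp
  then show False using x0 c by (simp add: mult_le_0_iff)
qed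

text \<open>Dropping the positive factor w^(\<alpha> - 1) gives a function \<open>h\<close> with the
  signs of \<sigma> that is continuous down to 0, where it equals 1. A nonpositive value would force
  a smallest zero by compactness, with \<open>h\<close> positive before it by the intermediate value
  theorem; \<open>sigma_no_first_zero\<close> excludes this.\<close>

lemma sigma_pos:
  assumes "0 < w"
  shows "0 < sigma_fun \<alpha> w"
proof (rule ccontr)
  assume neg: "\<not> 0 < sigma_fun \<alpha> w"
  define h where "h = (\<lambda>x. E (x powr \<beta>))"
  have "continuous_on UNIV E" 
    by (intro continuous_at_imp_continuous_on ballI isCont_E)
  moreover have "continuous_on {0..w} (\<lambda>x. x powr \<beta>)"
    by (rule continuous_on_powr') (use \<alpha>_pos in \<open>auto intro: continuous_intros\<close>)
  ultimately have cont: "continuous_on {0..w} h"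
    unfolding h_def by (rule continuous_on_compose2) simp
  have h0: "h 0 = 1" by (simp add: h_def E_def powser_zero)
  have sh: "0 < sigma_fun \<alpha> x \<longleftrightarrow> 0 < h x" "sigma_fun \<alpha> x = 0 \<longleftrightarrow> h x = 0" if "0 < x" for x
    using that by (simp_all add: sigma_fun_eq h_def zero_less_mult_iff)
  have hw: "h w \<le> 0" using neg sh(1)[OF assms] by simp
  define S where "S = {x \<in> {0..w}. h x = 0}"
  have "compact S"
    unfolding compact_eq_bounded_closed S_def
    using continuous_closed_preimage_constant[OF cont closed_atLeastAtMost]
    by (auto intro: bounded_subset[OF bounded_closed_interval[of 0 w]])
  moreover have "S \<noteq> {}"
    using IVT2'[of h w 0 0] cont h0 hw assms by (auto simp: S_def)
  ultimately obtain x0 where x0: "x0 \<in> S" "\<And>x. x \<in> S \<Longrightarrow> x0 \<le> x"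
    using compact_attains_inf by metis
  have "x0 \<noteq> 0" using x0(1) h0 by (auto simp: S_def)
  then have x0': "0 < x0" "x0 \<le> w" "h x0 = 0" using x0(1) by (auto simp: S_def)
  have "0 < h p" if p: "0 < p" "p < x0" for p
  proof (rule ccontr)
    assume "\<not> 0 < h p"
    then have "\<exists>q. 0 \<le> q \<and> q \<le> p \<and> h q = 0"
      using h0 p x0' by (intro IVT2' continuous_on_subset[OF cont]) auto
    then obtain q where "0 \<le> q" "q \<le> p" "h q = 0" by blast
    with x0(2)[of q] p x0' show False by (auto simp: S_def)
  qed
  then have "sigma_fun \<alpha> x0 \<noteq> 0" using x0' sh by (intro sigma_no_first_zero) auto
  then show False using sh x0' by blast
qed

section \<open>Monotonicity of \<open>F\<close> and the fixed point of \<open>G_fun\<close>\<close>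

lemma continuous_on_F:
  assumes "0 \<le> x"
  shows "continuous_on {0..x} F"
proof -
  have "continuous_on UNIV (\<lambda>y. \<Sum>n. b n * y ^ n)"
    by (intro continuous_at_imp_continuous_on ballI isCont_powser_converges_everywhere summable_b')
  moreover have "continuous_on {0..x} (\<lambda>x. x powr \<beta>)"
    by (rule continuous_on_powr') (use \<alpha>_pos in \<open>auto intro: continuous_intros\<close>)
  ultimately show ?thesis
    unfolding F_def[abs_def] by (rule continuous_on_compose2) simp
qed

lemma F_strict_antimono:
  assumes "0 \<le> x" "x < y"
  shows "F y < F x"
proof (rule DERIV_neg_imp_decreasing_open[OF assms(2)])
  show "continuous_on {x..y} F"
    using assms by (intro continuous_on_subset[OF continuous_on_F[of y]]) auto
  fix z assume z: "x < z" "z < y"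
  then have "- (z * sigma_fun \<alpha> z) / \<beta> < 0"
    using assms \<alpha>_pos by (intro divide_neg_pos) (auto simp: sigma_pos)
  then show "\<exists>D. (F has_real_derivative D) (at z) \<and> D < 0"
    using DERIV_F[of z] z assms by auto
qed

text \<open>By \<open>DERIV_F\<close>, -\<beta> F is an antiderivative of w \<sigma>(w), and
  positivity of \<sigma> supplies integrability. The limit Gamma \<alpha> of \<open>F\<close> at 0
  cancels the constant term g0 (1 + \<alpha>).\<close>

lemma G_fun_eq:
  assumes "0 \<le> x"
  shows "G_fun \<alpha> g0 x = g0 * \<beta> / Gamma \<alpha> * F x"
proof -
  have G0: "Gamma \<alpha> \<noteq> 0" using Gamma_real_pos[OF \<alpha>_pos] by simp
  have I: "(LBINT w=0..x. w * sigma_fun \<alpha> w) = \<beta> * Gamma \<alpha> - \<beta> * F x"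
  proof (cases "x = 0")
    case True
    then show ?thesis by (simp add: F_0 zero_ereal_def)
  next
    case False
    with assms have x: "0 < x" by simp
    have "(LBINT w=ereal 0..ereal x. w * sigma_fun \<alpha> w) = - (\<beta> * F x) - - (\<beta> * Gamma \<alpha>)"
    proof (rule interval_integral_FTC_nonneg(2)[where F = "\<lambda>w. - (\<beta> * F w)"])
      show "((\<lambda>w. - (\<beta> * F w)) has_real_derivative w * sigma_fun \<alpha> w) (at w)"
        if "ereal 0 < ereal w" for w
        using DERIV_minus[OF DERIV_cmult[OF DERIV_F[of w], of \<beta>]] that \<alpha>_pos by simp
      show "isCont (\<lambda>w. w * sigma_fun \<alpha> w) w" if "ereal 0 < ereal w" for w
        using that by (intro continuous_intros isCont_sigma) simp
      show "AE w in lborel. ereal 0 < ereal w \<longrightarrow> ereal w < ereal x \<longrightarrow> 0 \<le> w * sigma_fun \<alpha> w"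
        using sigma_pos by (auto intro!: AE_I2 mult_nonneg_nonneg less_imp_le)
      show "(((\<lambda>w. - (\<beta> * F w)) \<circ> real_of_ereal) \<longlongrightarrow> - (\<beta> * Gamma \<alpha>)) (at_right (ereal 0))"
        unfolding ereal_tendsto_simps1(2) by (intro tendsto_intros tendsto_F_0)
      have "isCont F x" using DERIV_F[OF x] DERIV_isCont by blast
      then have "(F \<longlongrightarrow> F x) (at_left x)" by (simp add: isCont_def filterlim_at_split)
      then show "(((\<lambda>w. - (\<beta> * F w)) \<circ> real_of_ereal) \<longlongrightarrow> - (\<beta> * F x)) (at_left (ereal x))"
        unfolding ereal_tendsto_simps1(1) by (intro tendsto_intros)
    qed (use x in auto)
    then show ?thesis by (simp add: zero_ereal_def)
  qed
  show ?thesis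
    unfolding G_fun_def I using G0 by (simp add: field_simps)
qed

lemma G_fun_fixed_point:
  assumes "0 < g0"
  shows "\<exists>!\<eta>. \<eta> > 0 \<and> G_fun \<alpha> g0 \<eta> = \<eta>"
proof -
  have Gp: "0 < Gamma \<alpha>" using \<alpha>_pos by simp
  define C where "C = g0 * \<beta> / Gamma \<alpha>"
  have C: "0 < C" using assms \<alpha>_pos Gp by (simp add: C_def)
  have mono: "C * F y - y < C * F x - x" if "0 \<le> x" "x < y" for x y
    using mult_strict_left_mono[OF F_strict_antimono[OF that] C] that by linarith
  \<comment> \<open>\<open>M\<close> is the value of C F at 0. As F decreases, C F x - x is positive
    at 0 and negative at \<open>M\<close>.\<close>
  define M where "M = C * Gamma \<alpha>"
  have M: "0 < M" using C Gp by (simp add: M_def)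
  have "\<exists>x\<ge>0. x \<le> M \<and> C * F x - x = 0"
  proof (rule IVT2')
    show "C * F M - M \<le> 0"
      using mult_strict_left_mono[OF F_strict_antimono[of 0 M] C] M by (simp add: F_0 M_def)
    show "0 \<le> C * F 0 - 0" using M by (simp add: F_0 M_def)
    show "continuous_on {0..M} (\<lambda>x. C * F x - x)"
      using M by (intro continuous_intros continuous_on_F) simp
  qed (use M in simp)
  then obtain \<eta> where \<eta>: "0 \<le> \<eta>" "C * F \<eta> = \<eta>" by auto
  have "\<eta> \<noteq> 0" using \<eta> M by (auto simp: F_0 M_def)
  show ?thesis
  proof (rule ex1I[of _ \<eta>])
    show "\<eta> > 0 \<and> G_fun \<alpha> g0 \<eta> = \<eta>"
      using \<eta> \<open>\<eta> \<noteq> 0\<close> by (simp add: G_fun_eq C_def)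
    fix y assume y: "y > 0 \<and> G_fun \<alpha> g0 y = y"
    have "C * F y = G_fun \<alpha> g0 y" using y by (subst G_fun_eq) (auto simp: C_def)
    then have "C * F y = y" using y by simp
    then show "y = \<eta>"
      using mono[of y \<eta>] mono[of \<eta> y] \<eta> y by (cases y \<eta> rule: linorder_cases) auto
  qed
qed

section \<open>The self-similar solution: derivatives, Caputo flux and boundary conditions\<close>

lemma v_sol_eq:
  "v_sol \<alpha> g0 gm \<eta> x t =
     gm + g0 / Gamma \<alpha> * (LBINT w=ereal (x / t powr (1 / \<beta>))..ereal \<eta>. sigma_fun \<alpha> w)"
  by (simp add: v_sol_def sigma_fun_def)

lemma DERIV_sigma_integral:
  assumes "0 < \<xi>" "0 < \<eta>"
  shows "((\<lambda>u. LBINT w=ereal u..ereal \<eta>. sigma_fun \<alpha> w) has_real_derivative - sigma_fun \<alpha> \<xi>) (at \<xi>)"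
proof -
  \<comment> \<open>The interval [l, r] contains \<eta>, has \<xi> in its interior and stays away
    from the singularity of \<sigma> at 0.\<close>
  define l r where "l = min \<xi> \<eta> / 2" and "r = max \<xi> \<eta> + 1"
  have lr: "0 < l" "l < \<xi>" "\<xi> < r" "l \<le> \<eta>" "\<eta> \<le> r"
    using assms by (auto simp: l_def r_def)
  have "continuous_on {l..r} (sigma_fun \<alpha>)"
    using lr by (intro continuous_at_imp_continuous_on ballI isCont_sigma) auto
  from interval_integral_FTC2[OF lr(4,5) this less_imp_le[OF lr(2)] less_imp_le[OF lr(3)]]
  have "((\<lambda>u. LBINT w=ereal \<eta>..ereal u. sigma_fun \<alpha> w) has_vector_derivative sigma_fun \<alpha> \<xi>) (at \<xi>)"
    unfolding at_within_Icc_at[OF lr(2,3)] .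
  then have "((\<lambda>u. - (LBINT w=ereal \<eta>..ereal u. sigma_fun \<alpha> w)) has_real_derivative - sigma_fun \<alpha> \<xi>) (at \<xi>)"
    unfolding has_real_derivative_iff_has_vector_derivative[symmetric] by (rule DERIV_minus)
  then show ?thesis
    by (subst interval_integral_endpoints_reverse)
qed

lemma DERIV_v_sol_x:
  assumes "0 < t" "0 < x" "0 < \<eta>"
  defines "k \<equiv> 1 / t powr (1 / \<beta>)"
  shows "((\<lambda>y. v_sol \<alpha> g0 gm \<eta> y t) has_real_derivative - (g0 / Gamma \<alpha>) * (k * sigma_fun \<alpha> (k * x))) (at x)"
proof -
  have k: "0 < k" "y / t powr (1 / \<beta>) = k * y" for y using assms by (auto simp: k_def)
  have "((\<lambda>y. LBINT w=ereal (k * y)..ereal \<eta>. sigma_fun \<alpha> w) has_real_derivative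
      - sigma_fun \<alpha> (k * x) * k) (at x)"
    by (rule DERIV_chain2[OF DERIV_sigma_integral]) (use assms k in \<open>auto intro!: derivative_eq_intros\<close>)
  from DERIV_add[OF DERIV_const DERIV_cmult[OF this, of "g0 / Gamma \<alpha>"], of gm]
  show ?thesis unfolding v_sol_eq k by (simp add: mult_ac)
qed

text \<open>Time enters only through the similarity variable x t^(-1/\<beta>), whose time derivative
  is -k x / (\<beta> t); the minus sign of the lower integration limit cancels this sign.\<close>

lemma DERIV_v_sol_t:
  assumes "0 < t" "0 < x" "0 < \<eta>"
  defines "k \<equiv> 1 / t powr (1 / \<beta>)"
  shows "((\<lambda>\<tau>. v_sol \<alpha> g0 gm \<eta> x \<tau>) has_real_derivative
     g0 / Gamma \<alpha> * (sigma_fun \<alpha> (k * x) * (k * x / (\<beta> * t)))) (at t)"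
proof -
  have kp: "0 < k" using assms by (simp add: k_def)
  have "((\<lambda>\<tau>. x * \<tau> powr (- (1 / \<beta>))) has_real_derivative x * (- (1 / \<beta>) * t powr (- (1 / \<beta>) - 1))) (at t)"
    by (rule DERIV_cmult[OF has_real_derivative_powr[OF assms(1)]])
  moreover have "x * (- (1 / \<beta>) * t powr (- (1 / \<beta>) - 1)) = - (k * x / (\<beta> * t))"
    using assms by (simp add: k_def powr_diff powr_minus divide_inverse)
  moreover have "(\<lambda>\<tau>. x * \<tau> powr (- (1 / \<beta>))) = (\<lambda>\<tau>. x / \<tau> powr (1 / \<beta>))"
    by (simp only: powr_minus divide_inverse[symmetric])
  ultimately have "((\<lambda>\<tau>. x / \<tau> powr (1 / \<beta>)) has_real_derivative - (k * x / (\<beta> * t))) (at t)"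
    by simp
  moreover have "((\<lambda>u. LBINT w=ereal u..ereal \<eta>. sigma_fun \<alpha> w) has_real_derivative - sigma_fun \<alpha> (k * x)) (at (x / t powr (1 / \<beta>)))"
    using DERIV_sigma_integral[of "k * x" \<eta>] kp assms by (simp add: k_def)
  ultimately have "((\<lambda>\<tau>. LBINT w=ereal (x / \<tau> powr (1 / \<beta>))..ereal \<eta>. sigma_fun \<alpha> w) has_real_derivative
      - sigma_fun \<alpha> (k * x) * - (k * x / (\<beta> * t))) (at t)"
    by (rule DERIV_chain2[rotated])
  from DERIV_add[OF DERIV_const DERIV_cmult[OF this, of "g0 / Gamma \<alpha>"], of gm]
  show ?thesis unfolding v_sol_eq by simp
qed

text \<open>The space derivative is a multiple of k \<sigma>(k p), so this is the scaled fractional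
  integral, whose factor Gamma (1 - \<alpha>) cancels the Caputo normalization.\<close>

lemma caputo_v_sol:
  assumes "0 < t" "0 < x" "0 < \<eta>"
  defines "k \<equiv> 1 / t powr (1 / \<beta>)"
  shows "caputo_exists \<alpha> (\<lambda>y. v_sol \<alpha> g0 gm \<eta> y t) x"
    and "caputo \<alpha> (\<lambda>y. v_sol \<alpha> g0 gm \<eta> y t) x = - (g0 / Gamma \<alpha>) * k powr \<alpha> * F (k * x)"
proof -
  have k: "0 < k" using assms by (simp add: k_def)
  note D = DERIV_v_sol_x[OF assms(1) _ assms(3), folded k_def]
  have "indicator {0<..<x} p *\<^sub>R (deriv (\<lambda>y. v_sol \<alpha> g0 gm \<eta> y t) p / (x - p) powr \<alpha>)
    = - (g0 / Gamma \<alpha>) * (indicator {0<..<x} p * (k * sigma_fun \<alpha> (k * p) * (x - p) powr (- \<alpha>)))" for p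
    by (cases "p \<in> {0<..<x}") (simp_all add: DERIV_imp_deriv[OF D] powr_minus divide_inverse)
  then have I: "has_bochner_integral lborel
      (\<lambda>p. indicator {0<..<x} p *\<^sub>R (deriv (\<lambda>y. v_sol \<alpha> g0 gm \<eta> y t) p / (x - p) powr \<alpha>))
      (- (g0 / Gamma \<alpha>) * (Gamma (1 - \<alpha>) * k powr \<alpha> * F (k * x)))"
    using has_bochner_integral_mult_right[OF has_bochner_integral_fractional[OF k assms(2)], of "- (g0 / Gamma \<alpha>)"]
    by simp
  have ei: "einterval 0 (ereal x) = {0<..<x}" "0 \<le> ereal x"
    using assms(2) by (auto simp: einterval_def)
  show "caputo_exists \<alpha> (\<lambda>y. v_sol \<alpha> g0 gm \<eta> y t) x"
    unfolding caputo_exists_def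
  proof (intro conjI ballI)
    show "(\<lambda>y. v_sol \<alpha> g0 gm \<eta> y t) field_differentiable at p" if "p \<in> {0<..<x}" for p
      using D[of p g0 gm] that unfolding field_differentiable_def by auto
    show "interval_lebesgue_integrable lborel 0 (ereal x)
        (\<lambda>p. deriv (\<lambda>y. v_sol \<alpha> g0 gm \<eta> y t) p / (x - p) powr \<alpha>)"
      unfolding interval_lebesgue_integrable_def set_integrable_def if_P[OF ei(2)] ei(1)
      using I by (rule integrable.intros)
  qed
  have "0 < Gamma (1 - \<alpha>)" using \<alpha>_less_1 by (intro Gamma_real_pos) simp
  then have "Gamma (1 - \<alpha>) \<noteq> 0" by (rule less_imp_neq[symmetric])
  then show "caputo \<alpha> (\<lambda>y. v_sol \<alpha> g0 gm \<eta> y t) x = - (g0 / Gamma \<alpha>) * k powr \<alpha> * F (k * x)"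
    using has_bochner_integral_integral_eq[OF I]
    unfolding caputo_def interval_lebesgue_integral_def set_lebesgue_integral_def if_P[OF ei(2)] ei(1)
    by simp
qed

lemma stefan_solution_v_s:
  assumes \<eta>: "0 < \<eta>" "G_fun \<alpha> g0 \<eta> = \<eta>"
  shows "stefan_solution \<alpha> T g0 gm (v_sol \<alpha> g0 gm \<eta>) (s_sol \<alpha> \<eta>)"
proof -
  define C where "C = g0 / Gamma \<alpha>"
  define k where "k = (\<lambda>t::real. 1 / t powr (1 / \<beta>))"
  have G0: "Gamma \<alpha> \<noteq> 0" using Gamma_real_pos[OF \<alpha>_pos] by simp
  have kpos: "0 < k t" if "0 < t" for t using that by (simp add: k_def)
  have k\<alpha>: "k t powr \<alpha> = t powr (- (\<alpha> / \<beta>))" if "0 < t" for t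
    using that by (simp add: k_def powr_divide powr_powr powr_minus_divide)
  \<comment> \<open>This scaling identity, from k^\<beta> = 1/t, is what matches the time derivative
    with the space derivative of the flux.\<close>
  have k\<beta>: "k t powr \<alpha> * k t = 1 / t" if "0 < t" for t
  proof -
    have "k t powr \<alpha> * k t = k t powr \<beta>"
      using kpos[OF that] by (simp add: powr_add)
    also have "\<dots> = 1 / t"
      using that \<alpha>_pos by (simp add: k_def powr_divide powr_powr)
    finally show ?thesis .
  qed
  have caputo_eq: "caputo \<alpha> (\<lambda>y. v_sol \<alpha> g0 gm \<eta> y t) x = - C * k t powr \<alpha> * F (k t * x)"
    if "0 < t" "0 < x" for t x
    using caputo_v_sol(2)[OF that \<eta>(1)] by (simp add: C_def k_def)
  have s: "k t * s_sol \<alpha> \<eta> t = \<eta>" "0 < s_sol \<alpha> \<eta> t" if "0 < t" for t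
    using that \<eta> by (simp_all add: k_def s_sol_def)
  have heat: "\<exists>vt dx. ((\<lambda>\<tau>. v_sol \<alpha> g0 gm \<eta> x \<tau>) has_real_derivative vt) (at t) \<and>
      (caputo \<alpha> (\<lambda>y. v_sol \<alpha> g0 gm \<eta> y t) has_real_derivative dx) (at x) \<and> vt - dx = 0"
    if t: "0 < t" "0 < x" for t x
  proof (intro exI conjI)
    show "((\<lambda>\<tau>. v_sol \<alpha> g0 gm \<eta> x \<tau>) has_real_derivative
        C * (sigma_fun \<alpha> (k t * x) * (k t * x / (\<beta> * t)))) (at t)"
      using DERIV_v_sol_t[OF t \<eta>(1)] by (simp add: C_def k_def)
    have "((\<lambda>y. F (k t * y)) has_real_derivative - (k t * x * sigma_fun \<alpha> (k t * x)) / \<beta> * k t) (at x)"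
      by (rule DERIV_chain2[OF DERIV_F]) (use t kpos in \<open>auto intro!: derivative_eq_intros\<close>)
    \<comment> \<open>The flux formula holds at all positive arguments, an open set around x, so the
      derivative of the formula is that of the flux.\<close>
    from DERIV_cmult[OF this, of "- C * k t powr \<alpha>"]
    show "(caputo \<alpha> (\<lambda>y. v_sol \<alpha> g0 gm \<eta> y t) has_real_derivative
        - C * k t powr \<alpha> * (- (k t * x * sigma_fun \<alpha> (k t * x)) / \<beta> * k t)) (at x)"
      by (rule has_field_derivative_transform_within_open[where S = "{0<..}"])
         (use t caputo_eq in auto)
    have "- C * k t powr \<alpha> * (- (k t * x * sigma_fun \<alpha> (k t * x)) / \<beta> * k t)
      = C * (k t * x * sigma_fun \<alpha> (k t * x) / \<beta>) * (k t powr \<alpha> * k t)"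
      by simp
    also have "\<dots> = C * (sigma_fun \<alpha> (k t * x) * (k t * x / (\<beta> * t)))"
      unfolding k\<beta>[OF t(1)] by simp
    finally show "C * (sigma_fun \<alpha> (k t * x) * (k t * x / (\<beta> * t))) -
      - C * k t powr \<alpha> * (- (k t * x * sigma_fun \<alpha> (k t * x)) / \<beta> * k t) = 0" by simp
  qed
  have flux0: "(caputo \<alpha> (\<lambda>y. v_sol \<alpha> g0 gm \<eta> y t) \<longlongrightarrow> - g0 * t powr (- (\<alpha> / \<beta>))) (at_right 0)"
    if t: "0 < t" for t
  proof -
    have "filterlim (\<lambda>y. k t * y) (at_right 0) (at_right 0)"
      using kpos[OF t] by (auto simp: filterlim_at eventually_at_filter intro!: tendsto_eq_intros)
    from filterlim_compose[OF tendsto_F_0 this]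
    have "((\<lambda>y. - C * k t powr \<alpha> * F (k t * y)) \<longlongrightarrow> - C * k t powr \<alpha> * Gamma \<alpha>) (at_right 0)"
      by (intro tendsto_intros)
    moreover have "- C * k t powr \<alpha> * Gamma \<alpha> = - g0 * t powr (- (\<alpha> / \<beta>))"
      using G0 k\<alpha>[OF t] by (simp add: C_def)
    moreover have "\<forall>\<^sub>F y in at_right 0. - C * k t powr \<alpha> * F (k t * y) = caputo \<alpha> (\<lambda>y. v_sol \<alpha> g0 gm \<eta> y t) y"
      using caputo_eq[OF t] by (auto simp: eventually_at_filter)
    ultimately show ?thesis
      using tendsto_cong by force
  qed
  have free: "\<exists>q. (caputo \<alpha> (\<lambda>y. v_sol \<alpha> g0 gm \<eta> y t) \<longlongrightarrow> q) (at_left (s_sol \<alpha> \<eta> t)) \<and>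
       (s_sol \<alpha> \<eta> has_real_derivative - q) (at t)" if t: "0 < t" for t
  proof (intro exI conjI)
    have "isCont F (k t * s_sol \<alpha> \<eta> t)"
      using DERIV_F[OF \<eta>(1)] s(1)[OF t] DERIV_isCont by metis
    then have "isCont (\<lambda>y. - C * k t powr \<alpha> * F (k t * y)) (s_sol \<alpha> \<eta> t)"
      by (intro continuous_intros isCont_o2[of _ "\<lambda>y. k t * y"])
    then have "((\<lambda>y. - C * k t powr \<alpha> * F (k t * y)) \<longlongrightarrow> - C * k t powr \<alpha> * F \<eta>) (at_left (s_sol \<alpha> \<eta> t))"
      using s(1)[OF t] by (simp add: isCont_def filterlim_at_split)
    moreover have "\<forall>\<^sub>F y in at_left (s_sol \<alpha> \<eta> t).
        - C * k t powr \<alpha> * F (k t * y) = caputo \<alpha> (\<lambda>y. v_sol \<alpha> g0 gm \<eta> y t) y"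
      using s(2)[OF t] caputo_eq[OF t] by (intro eventually_at_leftI[of 0]) auto
    ultimately show "(caputo \<alpha> (\<lambda>y. v_sol \<alpha> g0 gm \<eta> y t) \<longlongrightarrow> - C * k t powr \<alpha> * F \<eta>) (at_left (s_sol \<alpha> \<eta> t))"
      using tendsto_cong by force
    \<comment> \<open>The fixed point equation for \<eta> is used exactly here: it equates the flux
      at the front with the speed (\<eta>/\<beta>) t^(1/\<beta> - 1).\<close>
    have "C * F \<eta> = \<eta> / \<beta>"
      using G_fun_eq[of \<eta> g0] \<eta> \<alpha>_pos G0 by (simp add: C_def eq_divide_eq divide_eq_eq mult_ac)
    moreover have "- (- C * k t powr \<alpha> * F \<eta>) = C * F \<eta> * t powr (- (\<alpha> / \<beta>))"
      using k\<alpha>[OF t] by simp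
    ultimately have "- (- C * k t powr \<alpha> * F \<eta>) = \<eta> * (1 / \<beta> * t powr (- (\<alpha> / \<beta>)))"
      by simp
    moreover have "1 / \<beta> - 1 = - (\<alpha> / \<beta>)" using \<alpha>_pos by (simp add: field_simps)
    moreover have "(s_sol \<alpha> \<eta> has_real_derivative \<eta> * (1 / \<beta> * t powr (1 / \<beta> - 1))) (at t)"
      unfolding s_sol_def[abs_def] by (rule DERIV_cmult[OF has_real_derivative_powr[OF t]])
    ultimately show "(s_sol \<alpha> \<eta> has_real_derivative - (- C * k t powr \<alpha> * F \<eta>)) (at t)"
      by simp
  qed
  \<comment> \<open>On the free boundary the similarity variable equals \<eta>, so the integral has
    equal limits.\<close>
  have "v_sol \<alpha> g0 gm \<eta> (s_sol \<alpha> \<eta> t) t = gm" if "0 < t" for t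
    using that by (simp add: v_sol_eq s_sol_def)
  moreover have "s_sol \<alpha> \<eta> 0 = 0" by (simp add: s_sol_def)
  ultimately show ?thesis
    unfolding stefan_solution_def
    using caputo_v_sol(1)[OF _ _ \<eta>(1)] heat flux0 free by blast
qed

end

theorem theorem3:
  fixes \<alpha> T g0 gm :: real
  assumes "0 < \<alpha>" and "\<alpha> < 1" and "0 < T" and "g0 > 0" and "g0 > gm"
  shows "(\<exists>!\<eta>. \<eta> > 0 \<and> G_fun \<alpha> g0 \<eta> = \<eta>) \<and>
         (\<forall>\<eta>. \<eta> > 0 \<and> G_fun \<alpha> g0 \<eta> = \<eta> \<longrightarrow>
            stefan_solution \<alpha> T g0 gm (v_sol \<alpha> g0 gm \<eta>) (s_sol \<alpha> \<eta>))"
proof -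
  interpret caputo_order \<alpha> by unfold_locales (use assms in auto)
  show ?thesis
    using G_fun_fixed_point[OF assms(4)] stefan_solution_v_s by blast
qed

end
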